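(* Let $B_\mu$ be the $U_q(sl(2,\mathbb{R}))$-module algebra of noncommutative projective coordinates described in the context, with generators $x_i,y_i$ ($i\in I$), their adjoined inverses, and parameters $\mu_{ij}=\mu^{(1)}_{ij}/\mu^{(2)}_{ij}$. Put $v_i=q^{1/2}x_iy_i^{-1}$ and $(ij)=q^{-1/2}x_iy_j-q^{1/2}y_ix_j$, and for different $i,j,k,l\in I$ let $$C_{ijkl}=(il)(kl)^{-1}(kj)(ij)^{-1}\in B_\mu .$$ Then: (i) $C_{ijkl}$ is invariant. (ii) $C_{ijkl}$ can be represented by the elements $v_i$ (i.e. it lies in the subalgebra of $B_\mu$ generated by the $v_m$ and the inverses of nonvanishing finite linear combinations of the $v_m$), and $$\begin{aligned}C_{ijkl}={}&(q+q^{-1}-\mu_{li})(v_i-v_l)\\ &\times\bigl((q+q^{-1}-\mu_{ki})v_k-(q+q^{-1}-\mu_{li})v_l+(\mu_{ki}-\mu_{li})v_i\bigr)^{-1}\\ &\times\bigl((q+q^{-1}-\mu_{ki})v_k-(q+q^{-1}-\mu_{ji})v_j+(\mu_{ki}-\mu_{ji})v_i\bigr)\\ &\times(q+q^{-1}-\mu_{ji})^{-1}(v_i-v_j)^{-1}.\end{aligned}$$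
   Context: Fix $q\in\mathbb{C}$ with $|q|=1$, $q\ne\pm1,\pm i$, and a square root $q^{1/2}$. $U_q(sl(2,\mathbb{R}))$ is the unital algebra generated by $E,F,K,K^{-1}$ with $KK^{-1}=K^{-1}K=1$, $KE=qEK$, $KF=q^{-1}FK$, $[E,F]=\frac{K^2-K^{-2}}{q-q^{-1}}$. It acts on algebras so that $E(1)=F(1)=0$, $K(1)=1$ and, for all $x,y$, $K(xy)=K(x)K(y)$, $E(xy)=E(x)K(y)+K^{-1}(x)E(y)$, $F(xy)=F(x)K(y)+K^{-1}(x)F(y)$. For a set $I$, $B_\mu$ is the unital complex algebra generated by $x_i,y_i,y_i^{-1}$ ($i\in I$) together with inverses $\left(\sum\alpha_ix_iy_i^{-1}\right)^{-1}$ of the nonvanishing finite linear combinations $\sum\alpha_ix_iy_i^{-1}$, with relations $y_iy_i^{-1}=y_i^{-1}y_i=1$, the relations saying that the adjoined elements are two-sided inverses, and, for $i\neq j$ in $I$, $$x_iy_i=qy_ix_i,\quad x_jx_i=\mu^{(1)}_{ij}x_ix_j,\quad y_jy_i=\mu^{(1)}_{ij}y_iy_j,$$ $$x_jy_i=\mu^{(2)}_{ij}y_ix_j+\bigl(\mu^{(1)}_{ij}-q^{-1}\mu^{(2)}_{ij}\bigr)x_iy_j,\quad y_jx_i=\mu^{(2)}_{ij}x_iy_j+\bigl(\mu^{(1)}_{ij}-q\mu^{(2)}_{ij}\bigr)y_ix_j .$$ Here $\mu^{(1)}_{ij},\mu^{(2)}_{ij}$ are nonzero complex parameters and, with $\mu_{ij}=\mu^{(1)}_{ij}/\mu^{(2)}_{ij}$,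 one has $\mu_{ij}\ne q+q^{-1}$, $\mu^{(1)}_{ji}=1/\mu^{(1)}_{ij}$ and $\mu^{(2)}_{ji}=\dfrac{1}{\mu^{(2)}_{ij}\,\mu_{ij}\,(q+q^{-1}-\mu_{ij})}$. The $U_q(sl(2,\mathbb{R}))$-action on $B_\mu$ is given by $E(x_i)=q^{1/2}y_i$, $E(y_i)=0$, $F(x_i)=0$, $F(y_i)=q^{-1/2}x_i$, $K(x_i)=q^{-1/2}x_i$, $K(y_i)=q^{1/2}y_i$ and the product rules above. An element $x\in B_\mu$ is called invariant if $E(x)=0$, $F(x)=0$, $K(x)=x$. *)

theory Defs
  imports
    Complex_Main
    "HOL-Library.Poly_Mapping"
    "HOL-Algebra.QuotRing"
    "HOL-Algebra.Generated_Rings"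
begin

section \<open>Free complex algebras\<close>

text \<open>
  Words form the free monoid, so that \<open>'g list \<Rightarrow>\<^sub>0 complex\<close> with the convolution
  product of \<^theory>\<open>HOL-Library.Poly_Mapping\<close> is the free unital complex algebra on \<open>'g\<close>.
\<close>

instantiation list :: (type) monoid_add
begin

definition zero_list :: "'a list" where "zero_list = []"

definition plus_list :: "'a list \<Rightarrow> 'a list \<Rightarrow> 'a list" where "plus_list = (@)"

instance by standard (simp_all add: zero_list_def plus_list_def)

end

definition scalar :: "complex \<Rightarrow> ('g list \<Rightarrow>\<^sub>0 complex)" where
  "scalar c = Poly_Mapping.single [] c"

definition gen :: "'g \<Rightarrow> ('g list \<Rightarrow>\<^sub>0 complex)" where
  "gen g = Poly_Mapping.single [g] 1"

definition free_alg :: "('g list \<Rightarrow>\<^sub>0 complex) ring" where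
  "free_alg = \<lparr>carrier = UNIV, mult = (*), one = 1, zero = 0, add = (+)\<rparr>"


section \<open>The algebra of noncommutative projective coordinates\<close>

text \<open>
  \<open>Linv \<alpha>\<close> stands for the adjoined inverse of \<open>\<Sum>m. \<alpha> m x\<^sub>m y\<^sub>m\<^sup>-\<^sup>1\<close>, where \<open>\<alpha>\<close> is a finitely
  supported family of coefficients.  Nonvanishing of such a combination is read formally, as
  \<open>\<alpha> \<noteq> 0\<close>: the combinations are indexed before the algebra exists.
\<close>

datatype 'i coord = X 'i | Y 'i | Yinv 'i | Linv "'i \<Rightarrow>\<^sub>0 complex"

type_synonym 'i coord_alg = "'i coord list \<Rightarrow>\<^sub>0 complex"

definition lin_comb :: "('i \<Rightarrow>\<^sub>0 complex) \<Rightarrow> 'i coord_alg" where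
  "lin_comb \<alpha> = (\<Sum>m\<in>Poly_Mapping.keys \<alpha>.
     scalar (Poly_Mapping.lookup \<alpha> m) * (gen (X m) * gen (Yinv m)))"

text \<open>
  Each relation \<open>a = b\<close> is recorded as \<open>a - b\<close>.  The datatype has a superfluous symbol
  \<open>Linv 0\<close>; the relator \<open>Linv_zero\<close> removes it, so that it contributes no generator.
\<close>

inductive_set relators ::
    "complex \<Rightarrow> ('i \<Rightarrow> 'i \<Rightarrow> complex) \<Rightarrow> ('i \<Rightarrow> 'i \<Rightarrow> complex) \<Rightarrow> 'i coord_alg set"
  for q :: complex and \<mu>1 \<mu>2 :: "'i \<Rightarrow> 'i \<Rightarrow> complex"
where
  Y_Yinv: "gen (Y i) * gen (Yinv i) - 1 \<in> relators q \<mu>1 \<mu>2"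
| Yinv_Y: "gen (Yinv i) * gen (Y i) - 1 \<in> relators q \<mu>1 \<mu>2"
| lin_Linv: "\<alpha> \<noteq> 0 \<Longrightarrow> lin_comb \<alpha> * gen (Linv \<alpha>) - 1 \<in> relators q \<mu>1 \<mu>2"
| Linv_lin: "\<alpha> \<noteq> 0 \<Longrightarrow> gen (Linv \<alpha>) * lin_comb \<alpha> - 1 \<in> relators q \<mu>1 \<mu>2"
| Linv_zero: "gen (Linv 0) \<in> relators q \<mu>1 \<mu>2"
| X_Y_same: "gen (X i) * gen (Y i) - scalar q * (gen (Y i) * gen (X i)) \<in> relators q \<mu>1 \<mu>2"
| X_X: "i \<noteq> j \<Longrightarrow>
    gen (X j) * gen (X i) - scalar (\<mu>1 i j) * (gen (X i) * gen (X j)) \<in> relators q \<mu>1 \<mu>2"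
| Y_Y: "i \<noteq> j \<Longrightarrow>
    gen (Y j) * gen (Y i) - scalar (\<mu>1 i j) * (gen (Y i) * gen (Y j)) \<in> relators q \<mu>1 \<mu>2"
| X_Y: "i \<noteq> j \<Longrightarrow>
    gen (X j) * gen (Y i) -
      (scalar (\<mu>2 i j) * (gen (Y i) * gen (X j)) +
       scalar (\<mu>1 i j - inverse q * \<mu>2 i j) * (gen (X i) * gen (Y j))) \<in> relators q \<mu>1 \<mu>2"
| Y_X: "i \<noteq> j \<Longrightarrow>
    gen (Y j) * gen (X i) -
      (scalar (\<mu>2 i j) * (gen (X i) * gen (Y j)) +
       scalar (\<mu>1 i j - q * \<mu>2 i j) * (gen (Y i) * gen (X j))) \<in> relators q \<mu>1 \<mu>2"

definition rel_ideal ::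
    "complex \<Rightarrow> ('i \<Rightarrow> 'i \<Rightarrow> complex) \<Rightarrow> ('i \<Rightarrow> 'i \<Rightarrow> complex) \<Rightarrow> 'i coord_alg set" where
  "rel_ideal q \<mu>1 \<mu>2 = genideal free_alg (relators q \<mu>1 \<mu>2)"

definition proj_coords ::
    "complex \<Rightarrow> ('i \<Rightarrow> 'i \<Rightarrow> complex) \<Rightarrow> ('i \<Rightarrow> 'i \<Rightarrow> complex) \<Rightarrow> 'i coord_alg set ring" where
  "proj_coords q \<mu>1 \<mu>2 = free_alg Quot (rel_ideal q \<mu>1 \<mu>2)"

definition proj_class ::
    "complex \<Rightarrow> ('i \<Rightarrow> 'i \<Rightarrow> complex) \<Rightarrow> ('i \<Rightarrow> 'i \<Rightarrow> complex) \<Rightarrow> 'i coord_alg \<Rightarrow> 'i coord_alg set"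
  where "proj_class q \<mu>1 \<mu>2 a = rel_ideal q \<mu>1 \<mu>2 +>\<^bsub>free_alg\<^esub> a"


section \<open>Actions of \<open>U\<^sub>q(sl(2,\<real>))\<close>\<close>

text \<open>
  A unital complex algebra is given by a ring \<open>B\<close> and its structure map \<open>\<iota> :: complex \<Rightarrow> B\<close>.
  As \<open>U\<^sub>q(sl(2,\<real>))\<close> is presented by \<open>E, F, K, K\<^sup>-\<^sup>1\<close>, an action on \<open>B\<close> amounts to four linear
  operators on \<open>B\<close> satisfying the defining relations; \<open>L\<close> is the operator of \<open>K\<^sup>-\<^sup>1\<close>.
\<close>

definition linear_op :: "('a, 'b) ring_scheme \<Rightarrow> (complex \<Rightarrow> 'a) \<Rightarrow> ('a \<Rightarrow> 'a) \<Rightarrow> bool" where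
  "linear_op B \<iota> T \<longleftrightarrow>
     T \<in> carrier B \<rightarrow> carrier B \<and>
     (\<forall>a\<in>carrier B. \<forall>b\<in>carrier B. T (a \<oplus>\<^bsub>B\<^esub> b) = T a \<oplus>\<^bsub>B\<^esub> T b) \<and>
     (\<forall>c. \<forall>a\<in>carrier B. T (\<iota> c \<otimes>\<^bsub>B\<^esub> a) = \<iota> c \<otimes>\<^bsub>B\<^esub> T a)"

locale Uq_module_algebra =
  fixes B :: "('a, 'b) ring_scheme" (structure)
    and \<iota> :: "complex \<Rightarrow> 'a" and q :: complex and E F K L :: "'a \<Rightarrow> 'a"
  assumes linear: "linear_op B \<iota> E" "linear_op B \<iota> F" "linear_op B \<iota> K" "linear_op B \<iota> L"
    and KL: "a \<in> carrier B \<Longrightarrow> K (L a) = a"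
    and LK: "a \<in> carrier B \<Longrightarrow> L (K a) = a"
    and KE: "a \<in> carrier B \<Longrightarrow> K (E a) = \<iota> q \<otimes> E (K a)"
    and KF: "a \<in> carrier B \<Longrightarrow> K (F a) = \<iota> (inverse q) \<otimes> F (K a)"
    and EF: "a \<in> carrier B \<Longrightarrow>
      E (F a) \<ominus> F (E a) = \<iota> (1 / (q - inverse q)) \<otimes> (K (K a) \<ominus> L (L a))"
    and E_one: "E \<one> = \<zero>"
    and F_one: "F \<one> = \<zero>"
    and K_one: "K \<one> = \<one>"
    and K_mult: "\<lbrakk>a \<in> carrier B; b \<in> carrier B\<rbrakk> \<Longrightarrow> K (a \<otimes> b) = K a \<otimes> K b"
    and E_mult: "\<lbrakk>a \<in> carrier B; b \<in> carrier B\<rbrakk> \<Longrightarrow> E (a \<otimes> b) = E a \<otimes> K b \<oplus> L a \<otimes> E b"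
    and F_mult: "\<lbrakk>a \<in> carrier B; b \<in> carrier B\<rbrakk> \<Longrightarrow> F (a \<otimes> b) = F a \<otimes> K b \<oplus> L a \<otimes> F b"

definition invariant ::
    "('a, 'b) ring_scheme \<Rightarrow> ('a \<Rightarrow> 'a) \<Rightarrow> ('a \<Rightarrow> 'a) \<Rightarrow> ('a \<Rightarrow> 'a) \<Rightarrow> 'a \<Rightarrow> bool" where
  "invariant B E F K a \<longleftrightarrow> a \<in> carrier B \<and> E a = \<zero>\<^bsub>B\<^esub> \<and> F a = \<zero>\<^bsub>B\<^esub> \<and> K a = a"

text \<open>
  The unital complex subalgebra generated by a family \<open>v\<close> and the inverses of its
  linear combinations with finitely supported coefficient families \<open>\<alpha> \<noteq> 0\<close>.
\<close>

definition localized_subalgebra ::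
    "('a, 'b) ring_scheme \<Rightarrow> (complex \<Rightarrow> 'a) \<Rightarrow> ('i \<Rightarrow> 'a) \<Rightarrow> 'a set" where
  "localized_subalgebra B \<iota> v = generate_ring B
     (range \<iota> \<union> range v \<union>
      {inv\<^bsub>B\<^esub> (\<Oplus>\<^bsub>B\<^esub>m\<in>Poly_Mapping.keys \<alpha>. \<iota> (Poly_Mapping.lookup \<alpha> m) \<otimes>\<^bsub>B\<^esub> v m) | \<alpha>. \<alpha> \<noteq> 0})"

end

theory Submission
  imports Defs
begin

text \<open>
  The brackets are quantum determinants of doublets, hence invariant, and invariance passes to
  products and inverses.  For the formula, solve the exchange relations for \<open>y\<^sub>m x\<^sub>n\<close> to obtain
  \<open>y\<^sub>m v\<^sub>n = (\<mu>\<^sub>m\<^sub>n v\<^sub>n - (\<mu>\<^sub>m\<^sub>n - q\<^sup>-\<^sup>1) v\<^sub>m) y\<^sub>m\<close>; it gives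
  \<open>(mn) = \<mu>\<^sub>m\<^sub>n (v\<^sub>m - v\<^sub>n) y\<^sub>m y\<^sub>n = y\<^sub>m (v\<^sub>m - v\<^sub>n) y\<^sub>n\<close>.  In \<open>(il)(kl)\<^sup>-\<^sup>1(kj)(ij)\<^sup>-\<^sup>1\<close> all
  \<open>y\<close> cancel but a conjugation of \<open>(v\<^sub>k - v\<^sub>l)\<^sup>-\<^sup>1 (v\<^sub>k - v\<^sub>j)\<close> by \<open>y\<^sub>i\<close>, which turns \<open>v\<^sub>k - v\<^sub>n\<close> into
  \<open>\<mu>\<^sub>i\<^sub>k v\<^sub>k - \<mu>\<^sub>i\<^sub>n v\<^sub>n + (\<mu>\<^sub>i\<^sub>n - \<mu>\<^sub>i\<^sub>k) v\<^sub>i\<close>.  The symmetry of the parameters reads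
  \<open>\<mu>\<^sub>m\<^sub>n = q + q\<^sup>-\<^sup>1 - \<mu>\<^sub>n\<^sub>m\<close>.
\<close>

text \<open>Cancels scalars inside the right-nested products that repeated use of
  \<open>scale_scale\<close> produces.\<close>

lemma cancel_inverse_left:
  fixes c :: "'a :: field"
  assumes "c \<noteq> 0"
  shows "c * (inverse c * d) = d" "inverse c * (c * d) = d"
  using assms by simp_all

section \<open>Algebras over the complex numbers\<close>

text \<open>A complex algebra is taken as a ring with a central unital homomorphism from the complex
  numbers, so that the lemmas on rings stay available. The zero ring is allowed.\<close>

locale central_algebra = ring B for B (structure) +
  fixes \<iota> :: "complex \<Rightarrow> 'a"
  assumes \<iota>_closed [simp]: "\<iota> c \<in> carrier B"
    and \<iota>_add: "\<iota> (c + d) = \<iota> c \<oplus> \<iota> d"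
    and \<iota>_mult: "\<iota> (c * d) = \<iota> c \<otimes> \<iota> d"
    and \<iota>_one: "\<iota> 1 = \<one>"
    and \<iota>_central: "a \<in> carrier B \<Longrightarrow> a \<otimes> \<iota> c = \<iota> c \<otimes> a"
begin

definition scale :: "complex \<Rightarrow> 'a \<Rightarrow> 'a" (infixr "\<cdot>" 75) where
  "c \<cdot> a = \<iota> c \<otimes> a"

lemma scale_closed [simp, intro]: "a \<in> carrier B \<Longrightarrow> c \<cdot> a \<in> carrier B"
  by (simp add: scale_def)

lemma scale_scale: "a \<in> carrier B \<Longrightarrow> c \<cdot> d \<cdot> a = (c * d) \<cdot> a"
  by (simp add: scale_def \<iota>_mult m_assoc)

lemma scale_one: "a \<in> carrier B \<Longrightarrow> 1 \<cdot> a = a"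
  by (simp add: scale_def \<iota>_one)

lemma scale_add_left: "a \<in> carrier B \<Longrightarrow> (c + d) \<cdot> a = c \<cdot> a \<oplus> d \<cdot> a"
  by (simp add: scale_def \<iota>_add l_distr)

lemma scale_add_right: "\<lbrakk>a \<in> carrier B; b \<in> carrier B\<rbrakk> \<Longrightarrow> c \<cdot> (a \<oplus> b) = c \<cdot> a \<oplus> c \<cdot> b"
  by (simp add: scale_def r_distr)

lemma scale_mult_left: "\<lbrakk>a \<in> carrier B; b \<in> carrier B\<rbrakk> \<Longrightarrow> (c \<cdot> a) \<otimes> b = c \<cdot> (a \<otimes> b)"
  by (simp add: scale_def m_assoc)

lemma scale_mult_right: "\<lbrakk>a \<in> carrier B; b \<in> carrier B\<rbrakk> \<Longrightarrow> a \<otimes> (c \<cdot> b) = c \<cdot> (a \<otimes> b)"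
  by (metis scale_def \<iota>_central \<iota>_closed m_assoc)

lemma scale_zero_left: assumes "a \<in> carrier B" shows "0 \<cdot> a = \<zero>"
proof -
  have "0 \<cdot> a \<oplus> 0 \<cdot> a = 0 \<cdot> a"
    using scale_add_left[OF assms, of 0 0] by simp
  then show ?thesis
    using assms by (metis add.l_cancel_one scale_closed)
qed

lemma scale_zero_right: "c \<cdot> \<zero> = \<zero>"
  by (simp add: scale_def)

lemma a_inv_eq_scale: assumes "a \<in> carrier B" shows "\<ominus> a = (-1) \<cdot> a"
proof -
  have "(-1) \<cdot> a \<oplus> a = (-1 + 1) \<cdot> a"
    using assms by (simp only: scale_add_left scale_one)
  then have "(-1) \<cdot> a \<oplus> a = \<zero>"
    using assms by (simp add: scale_zero_left)
  then show ?thesis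
    using assms by (metis minus_equality scale_closed)
qed

lemma minus_eq_scale: "\<lbrakk>a \<in> carrier B; b \<in> carrier B\<rbrakk> \<Longrightarrow> a \<ominus> b = a \<oplus> (-1) \<cdot> b"
  by (simp add: a_minus_def a_inv_eq_scale)

text \<open>The shift \<open>e\<close> drops out of the coefficient of \<open>R\<close>. In
  \<open>y_diff\<close> it is \<open>inverse q\<close>, and the two minuends are instances of
  \<open>y_v\<close>.\<close>

lemma diff_diff_collect:
  assumes "P \<in> carrier B" "Q \<in> carrier B" "R \<in> carrier B"
  shows "(a \<cdot> P \<ominus> (a - e) \<cdot> R) \<ominus> (b \<cdot> Q \<ominus> (b - e) \<cdot> R) = a \<cdot> P \<ominus> b \<cdot> Q \<oplus> (b - a) \<cdot> R"
proof -
  have "(b - a) \<cdot> R = (e - a) \<cdot> R \<oplus> (b - e) \<cdot> R"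
    using assms by (simp flip: scale_add_left)
  then show ?thesis
    using assms by (simp add: minus_eq_scale scale_add_right scale_scale a_ac)
qed

text \<open>Serves with \<open>e = inverse q\<close>: the stray multiple of \<open>P\<close>
  completes \<open>e\<close> to \<open>a\<close>, so that \<open>a\<close> becomes a common
  factor.\<close>

lemma diff_collect:
  assumes "P \<in> carrier B" "Q \<in> carrier B"
  shows "e \<cdot> P \<ominus> (a \<cdot> Q \<ominus> (a - e) \<cdot> P) = a \<cdot> (P \<ominus> Q)"
proof -
  have "a \<cdot> P = e \<cdot> P \<oplus> (a - e) \<cdot> P"
    using assms by (simp flip: scale_add_left)
  then show ?thesis
    using assms by (simp add: minus_eq_scale scale_add_right scale_scale a_ac)
qed

lemma minus_l_distr:
  "\<lbrakk>a \<in> carrier B; b \<in> carrier B; c \<in> carrier B\<rbrakk> \<Longrightarrow> (a \<ominus> b) \<otimes> c = a \<otimes> c \<ominus> b \<otimes> c"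
  by (simp add: minus_eq_scale l_distr scale_mult_left)

lemma minus_r_distr:
  "\<lbrakk>a \<in> carrier B; b \<in> carrier B; c \<in> carrier B\<rbrakk> \<Longrightarrow> c \<otimes> (a \<ominus> b) = c \<otimes> a \<ominus> c \<otimes> b"
  by (simp add: minus_eq_scale r_distr scale_mult_right)

lemmas scale_simps = scale_scale scale_one scale_add_right scale_mult_left scale_mult_right
  scale_zero_left scale_zero_right minus_eq_scale l_distr r_distr m_assoc

lemma scale_cancel:
  assumes "c \<noteq> 0" "a \<in> carrier B" "b \<in> carrier B" "c \<cdot> a = c \<cdot> b"
  shows "a = b"
proof -
  have "(inverse c * c) \<cdot> a = (inverse c * c) \<cdot> b"
    using assms by (metis scale_scale)
  then show ?thesis
    using assms by (simp add: scale_one)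
qed

lemma inv_char:
  assumes "a \<in> carrier B" "b \<in> carrier B" "a \<otimes> b = \<one>" "b \<otimes> a = \<one>"
  shows "a \<in> Units B" "inv a = b"
proof -
  show *: "a \<in> Units B"
    using assms by (auto simp: Units_def)
  show "inv a = b"
    using assms * by (metis Units_inv_closed Units_l_inv inv_unique)
qed

lemma Units_cancel_inv:
  "\<lbrakk>a \<in> Units B; b \<in> carrier B\<rbrakk> \<Longrightarrow> a \<otimes> (inv a \<otimes> b) = b"
  "\<lbrakk>a \<in> Units B; b \<in> carrier B\<rbrakk> \<Longrightarrow> inv a \<otimes> (a \<otimes> b) = b"
  by (simp_all add: m_assoc[symmetric] Units_closed)

lemma inv_mult_Units:
  assumes "a \<in> Units B" "b \<in> Units B"
  shows "inv (a \<otimes> b) = inv b \<otimes> inv a"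
  by (rule inv_char) (use assms in \<open>simp_all add: m_assoc Units_closed Units_cancel_inv\<close>)

lemma scale_Units:
  assumes "c \<noteq> 0" "a \<in> Units B"
  shows "c \<cdot> a \<in> Units B" "inv (c \<cdot> a) = inverse c \<cdot> inv a"
  by (rule inv_char[where b = "inverse c \<cdot> inv a"];
      use assms in \<open>simp add: scale_simps Units_closed\<close>)+

end

text \<open>The adjoined inverses are indexed by finitely supported families, whereas concrete
  combinations come as sums over a finite set. Restricting \<open>c\<close> to \<open>A\<close>
  loses only zero terms, and the index \<open>m\<close> witnesses
  \<open>\<alpha> \<noteq> 0\<close>.\<close>

lemma (in central_algebra) finsum_eq_poly_mapping:
  assumes "finite A" "m \<in> A" "c m \<noteq> 0" "w \<in> A \<rightarrow> carrier B"
  obtains \<alpha> where "\<alpha> \<noteq> 0"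
    "(\<Oplus>n\<in>Poly_Mapping.keys \<alpha>. \<iota> (Poly_Mapping.lookup \<alpha> n) \<otimes> w n) = (\<Oplus>n\<in>A. c n \<cdot> w n)"
proof -
  define \<alpha> where "\<alpha> = Abs_poly_mapping (\<lambda>n. c n when n \<in> A)"
  have lookup: "Poly_Mapping.lookup \<alpha> = (\<lambda>n. c n when n \<in> A)"
    unfolding \<alpha>_def by (rule Abs_poly_mapping_inverse) (use assms(1) in simp)
  have keys: "Poly_Mapping.keys \<alpha> = {n \<in> A. c n \<noteq> 0}"
    by (auto simp: in_keys_iff lookup when_def split: if_splits)
  have "(\<Oplus>n\<in>A. c n \<cdot> w n) = (\<Oplus>n\<in>Poly_Mapping.keys \<alpha>. \<iota> (Poly_Mapping.lookup \<alpha> n) \<otimes> w n)"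
    by (rule add.finprod_mono_neutral_cong_right)
       (use assms(1,4) in \<open>auto simp: keys lookup scale_zero_left scale_def[symmetric] Pi_iff\<close>)
  moreover have "\<alpha> \<noteq> 0"
    using assms(2,3) keys by auto
  ultimately show ?thesis
    using that by metis
qed

section \<open>Relations among the quotient coordinates\<close>

text \<open>The computations take place in any algebra with elements obeying these relations, so
  cosets never appear in them. Adjoined inverses turn into membership in \<open>Units B\<close>, and
  \<open>r\<close> is the chosen square root of \<open>q\<close>.\<close>

locale coord_relations = central_algebra B \<iota> for B (structure) and \<iota> +
  fixes q r :: complex and \<mu>1 \<mu>2 :: "'i \<Rightarrow> 'i \<Rightarrow> complex" and x y :: "'i \<Rightarrow> 'a"
  assumes q_nonzero: "q \<noteq> 0"
    and r_square: "r ^ 2 = q"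
    and \<mu>2_nonzero: "m \<noteq> n \<Longrightarrow> \<mu>2 m n \<noteq> 0"
    and x_closed [simp]: "x m \<in> carrier B"
    and y_Units [simp]: "y m \<in> Units B"
    and xy_same: "x m \<otimes> y m = q \<cdot> (y m \<otimes> x m)"
    and yy: "m \<noteq> n \<Longrightarrow> y n \<otimes> y m = \<mu>1 m n \<cdot> (y m \<otimes> y n)"
    and xy: "m \<noteq> n \<Longrightarrow> x n \<otimes> y m =
      \<mu>2 m n \<cdot> (y m \<otimes> x n) \<oplus> (\<mu>1 m n - inverse q * \<mu>2 m n) \<cdot> (x m \<otimes> y n)"
    and lin_comb_Units: "\<alpha> \<noteq> 0 \<Longrightarrow>
      (\<Oplus>m\<in>Poly_Mapping.keys \<alpha>. Poly_Mapping.lookup \<alpha> m \<cdot> (x m \<otimes> inv (y m))) \<in> Units B"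
begin

definition \<mu> :: "'i \<Rightarrow> 'i \<Rightarrow> complex" where "\<mu> m n = \<mu>1 m n / \<mu>2 m n"

definition v :: "'i \<Rightarrow> 'a" where "v m = r \<cdot> (x m \<otimes> inv (y m))"

definition br :: "'i \<Rightarrow> 'i \<Rightarrow> 'a" where
  "br m n = inverse r \<cdot> (x m \<otimes> y n) \<ominus> r \<cdot> (y m \<otimes> x n)"

lemma r_nonzero [simp]: "r \<noteq> 0"
  using q_nonzero r_square by auto

lemma y_closed [simp]: "y m \<in> carrier B"
  by (simp add: Units_closed)

lemma v_closed [simp]: "v m \<in> carrier B"
  by (simp add: v_def)

lemma v_y: "v m \<otimes> y m = r \<cdot> x m"
  by (simp add: v_def scale_simps)

lemma x_eq: "x m = inverse r \<cdot> (v m \<otimes> y m)"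
  by (simp add: v_y scale_simps)

text \<open>Multiply \<open>xy_same\<close> on the right by the inverse of \<open>y m\<close>. The
  result agrees with the formula of \<open>y_v\<close> at \<open>n = m\<close>, where the two terms
  in \<open>\<mu>\<close> cancel.\<close>

lemma y_v_same: "y m \<otimes> v m = inverse q \<cdot> (v m \<otimes> y m)"
proof -
  have "x m = x m \<otimes> y m \<otimes> inv (y m)"
    by (simp add: m_assoc)
  also have "\<dots> = q \<cdot> (y m \<otimes> (x m \<otimes> inv (y m)))"
    by (simp add: xy_same scale_simps)
  finally have *: "q \<cdot> (y m \<otimes> (x m \<otimes> inv (y m))) = x m" ..
  have "q \<cdot> (y m \<otimes> v m) = r \<cdot> q \<cdot> (y m \<otimes> (x m \<otimes> inv (y m)))"
    by (simp add: v_def scale_simps mult.commute)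
  also have "\<dots> = q \<cdot> inverse q \<cdot> (v m \<otimes> y m)"
    using q_nonzero by (simp add: * v_y scale_simps cancel_inverse_left)
  finally have **: "q \<cdot> (y m \<otimes> v m) = q \<cdot> inverse q \<cdot> (v m \<otimes> y m)" .
  show ?thesis
    by (rule scale_cancel[OF q_nonzero _ _ **]) simp_all
qed

text \<open>Every term of \<open>xy\<close> other than \<open>y m \<otimes> x n\<close> can be
  written as some \<open>v\<close> times \<open>y m \<otimes> y n\<close>; for
  \<open>x n \<otimes> y m\<close> the reordering by \<open>yy\<close> costs
  \<open>\<mu>1 m n\<close>. Dividing by \<open>\<mu>2 m n\<close> leaves only the ratio
  \<open>\<mu> m n\<close>.\<close>

lemma y_x:
  assumes "m \<noteq> n"
  shows "y m \<otimes> x n = inverse r \<cdot> (\<mu> m n \<cdot> v n \<ominus> (\<mu> m n - inverse q) \<cdot> v m) \<otimes> (y m \<otimes> y n)"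
proof -
  have x_y: "x n \<otimes> y m = inverse r \<cdot> (\<mu>1 m n \<cdot> (v n \<otimes> (y m \<otimes> y n)))"
    by (simp add: x_eq[of n] yy[OF assms] scale_simps)
  have x_y': "x m \<otimes> y n = inverse r \<cdot> (v m \<otimes> (y m \<otimes> y n))"
    by (simp add: x_eq[of m] scale_simps)
  have *: "\<mu>2 m n \<cdot> (y m \<otimes> x n) = x n \<otimes> y m \<ominus> (\<mu>1 m n - inverse q * \<mu>2 m n) \<cdot> (x m \<otimes> y n)"
    by (simp add: xy[OF assms] a_minus_def a_assoc r_neg)
  have \<mu>1_eq: "\<mu>1 m n = \<mu>2 m n * \<mu> m n"
    using \<mu>2_nonzero[OF assms] by (simp add: \<mu>_def)
  show ?thesis
  proof (rule scale_cancel[OF \<mu>2_nonzero[OF assms]])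
    show "\<mu>2 m n \<cdot> (y m \<otimes> x n) = \<mu>2 m n \<cdot>
      (inverse r \<cdot> (\<mu> m n \<cdot> v n \<ominus> (\<mu> m n - inverse q) \<cdot> v m) \<otimes> (y m \<otimes> y n))"
      unfolding * x_y x_y' \<mu>1_eq
      by (simp add: scale_simps) (simp add: algebra_simps)
  qed simp_all
qed

lemma y_v:
  assumes "m \<noteq> n"
  shows "y m \<otimes> v n = (\<mu> m n \<cdot> v n \<ominus> (\<mu> m n - inverse q) \<cdot> v m) \<otimes> y m"
proof -
  have "y m \<otimes> v n = r \<cdot> (y m \<otimes> x n) \<otimes> inv (y n)"
    by (simp add: v_def scale_simps)
  also have "\<dots> = (\<mu> m n \<cdot> v n \<ominus> (\<mu> m n - inverse q) \<cdot> v m) \<otimes> y m"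
    by (simp add: y_x[OF assms] scale_simps cancel_inverse_left)
  finally show ?thesis .
qed

text \<open>The \<open>inverse q\<close> from \<open>y_v_same\<close> fits the one in
  \<open>y_v\<close>, so \<open>y m\<close> commutes with this difference up to the scalar
  \<open>\<mu> m n\<close>.\<close>

lemma y_diff_same:
  assumes "m \<noteq> n"
  shows "y m \<otimes> (v m \<ominus> v n) = \<mu> m n \<cdot> (v m \<ominus> v n) \<otimes> y m"
  by (simp add: y_v[OF assms] y_v_same scale_mult_left minus_l_distr minus_r_distr diff_collect)

lemma y_diff:
  assumes "i \<noteq> m" "i \<noteq> n"
  shows "y i \<otimes> (v m \<ominus> v n) =
    (\<mu> i m \<cdot> v m \<ominus> \<mu> i n \<cdot> v n \<oplus> (\<mu> i n - \<mu> i m) \<cdot> v i) \<otimes> y i"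
  by (simp add: y_v[OF assms(1)] y_v[OF assms(2)] scale_mult_left minus_l_distr minus_r_distr
      l_distr diff_diff_collect)

section \<open>Brackets and their cross ratio\<close>

lemma br_left:
  assumes "m \<noteq> n"
  shows "br m n = \<mu> m n \<cdot> (v m \<ominus> v n) \<otimes> (y m \<otimes> y n)"
proof -
  \<comment> \<open>The second \<open>inverse r\<close> comes from writing \<open>x m\<close>
    through \<open>v m\<close>; together they give the \<open>inverse q\<close> that
    \<open>diff_collect\<close> expects.\<close>
  have "inverse r \<cdot> (x m \<otimes> y n) = inverse q \<cdot> (v m \<otimes> (y m \<otimes> y n))"
    using r_square[symmetric] by (simp add: x_eq[of m] scale_simps power2_eq_square)
  moreover have "r \<cdot> (y m \<otimes> x n) =
      \<mu> m n \<cdot> (v n \<otimes> (y m \<otimes> y n)) \<ominus> (\<mu> m n - inverse q) \<cdot> (v m \<otimes> (y m \<otimes> y n))"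
    by (simp add: y_x[OF assms] scale_scale scale_one scale_mult_left minus_l_distr)
  ultimately show ?thesis
    by (simp add: br_def diff_collect scale_mult_left minus_l_distr)
qed

text \<open>Moving \<open>y m\<close> back to the left absorbs \<open>\<mu> m n\<close>, so this
  form is a product of units without any condition on \<open>\<mu>\<close>.\<close>

lemma br_right:
  assumes "m \<noteq> n"
  shows "br m n = y m \<otimes> ((v m \<ominus> v n) \<otimes> y n)"
  using y_diff_same[OF assms]
  by (simp add: br_left[OF assms] m_assoc[symmetric] scale_mult_left)


lemma y_diff_conj:
  assumes "i \<noteq> m" "i \<noteq> n"
  shows "y i \<otimes> ((v m \<ominus> v n) \<otimes> inv (y i)) =
    \<mu> i m \<cdot> v m \<ominus> \<mu> i n \<cdot> v n \<oplus> (\<mu> i n - \<mu> i m) \<cdot> v i"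
proof -
  have "y i \<otimes> ((v m \<ominus> v n) \<otimes> inv (y i)) = y i \<otimes> (v m \<ominus> v n) \<otimes> inv (y i)"
    by (simp add: m_assoc)
  also have "\<dots> = \<mu> i m \<cdot> v m \<ominus> \<mu> i n \<cdot> v n \<oplus> (\<mu> i n - \<mu> i m) \<cdot> v i"
    unfolding y_diff[OF assms] by (simp add: m_assoc)
  finally show ?thesis .
qed

lemma br_Units:
  assumes "m \<noteq> n" "v m \<ominus> v n \<in> Units B"
  shows "br m n \<in> Units B"
  using assms by (simp add: br_right)

text \<open>\<open>br i l\<close> and \<open>br i j\<close> are expanded by \<open>br_left\<close>,
  \<open>br k l\<close> and \<open>br k j\<close> by \<open>br_right\<close>. Then
  \<open>y l\<close>, \<open>y k\<close> and \<open>y j\<close> each meet their inverse, and what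
  remains in the middle is \<open>inv (D k l) \<otimes> D k j\<close> conjugated by
  \<open>y i\<close>, that is \<open>inv (W k l) \<otimes> W k j\<close>.\<close>

lemma cross_ratio:
  fixes i j k l
  defines "D \<equiv> \<lambda>m n. v m \<ominus> v n"
    and "W \<equiv> \<lambda>m n. \<mu> i m \<cdot> v m \<ominus> \<mu> i n \<cdot> v n \<oplus> (\<mu> i n - \<mu> i m) \<cdot> v i"
  assumes "distinct [i, j, k, l]" "\<mu> i j \<noteq> 0"
    and Units: "D k l \<in> Units B" "D i j \<in> Units B"
  shows "W k l \<in> Units B"
    and "br i l \<otimes> inv (br k l) \<otimes> br k j \<otimes> inv (br i j) =
      \<mu> i l \<cdot> D i l \<otimes> inv (W k l) \<otimes> W k j \<otimes> (inverse (\<mu> i j) \<cdot> inv (D i j))"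
proof -
  have neq: "i \<noteq> j" "i \<noteq> k" "i \<noteq> l" "k \<noteq> l" "k \<noteq> j"
    using assms(3) by auto
  have D: "v m \<ominus> v n = D m n" for m n
    by (simp add: D_def)
  have closed [simp]: "D m n \<in> carrier B" for m n
    by (simp add: D_def)
  \<comment> \<open>As a conjugate of \<open>D k n\<close>, \<open>W k n\<close> inherits
    invertibility and its inverse is the conjugate of the inverse.\<close>
  have W: "W k n = y i \<otimes> (D k n \<otimes> inv (y i))" if "i \<noteq> n" for n
    using y_diff_conj[of i k n] neq that by (simp add: D_def W_def)
  show "W k l \<in> Units B"
    using Units neq by (simp add: W)
  have inv_W: "inv (W k l) = y i \<otimes> (inv (D k l) \<otimes> inv (y i))"
    by (rule inv_char) (use Units neq in \<open>simp_all add: W m_assoc Units_cancel_inv\<close>)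
  have inv_kl: "inv (br k l) = inv (y l) \<otimes> (inv (D k l) \<otimes> inv (y k))"
    using neq Units by (simp add: br_right D inv_mult_Units m_assoc)
  have inv_ij: "inv (br i j) = inverse (\<mu> i j) \<cdot> (inv (y j) \<otimes> (inv (y i) \<otimes> inv (D i j)))"
    using neq Units assms(4)
    by (simp add: br_left D scale_mult_left scale_Units inv_mult_Units m_assoc)
  have il: "br i l = \<mu> i l \<cdot> (D i l \<otimes> (y i \<otimes> y l))"
    using neq by (simp add: br_left D scale_mult_left)
  have kj: "br k j = y k \<otimes> (D k j \<otimes> y j)"
    using neq by (simp add: br_right D)
  show "br i l \<otimes> inv (br k l) \<otimes> br k j \<otimes> inv (br i j) =
      \<mu> i l \<cdot> D i l \<otimes> inv (W k l) \<otimes> W k j \<otimes> (inverse (\<mu> i j) \<cdot> inv (D i j))"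
    unfolding inv_kl inv_ij il kj inv_W W[OF neq(1)]
    using Units
    by (simp add: scale_scale scale_mult_left scale_mult_right m_assoc Units_cancel_inv mult.commute)
qed

text \<open>The combination of the \<open>v m\<close> is \<open>r\<close> times the one whose
  inverse is adjoined.\<close>

lemma v_comb_Units:
  assumes "\<alpha> \<noteq> 0"
  shows "(\<Oplus>m\<in>Poly_Mapping.keys \<alpha>. \<iota> (Poly_Mapping.lookup \<alpha> m) \<otimes> v m) \<in> Units B"
proof -
  have "r \<cdot> (\<Oplus>m\<in>Poly_Mapping.keys \<alpha>. Poly_Mapping.lookup \<alpha> m \<cdot> (x m \<otimes> inv (y m))) =
      (\<Oplus>m\<in>Poly_Mapping.keys \<alpha>. r \<cdot> Poly_Mapping.lookup \<alpha> m \<cdot> (x m \<otimes> inv (y m)))"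
    unfolding scale_def[of r] by (rule finsum_rdistr) auto
  also have "\<dots> = (\<Oplus>m\<in>Poly_Mapping.keys \<alpha>. \<iota> (Poly_Mapping.lookup \<alpha> m) \<otimes> v m)"
    by (rule finsum_cong') (auto simp: v_def scale_def[symmetric] scale_scale mult.commute)
  finally show ?thesis
    using scale_Units(1)[OF r_nonzero lin_comb_Units[OF assms]] by simp
qed

section \<open>Inverses of combinations of the \<open>v m\<close> and the localized
  subalgebra\<close>

abbreviation V :: "'a set" where "V \<equiv> localized_subalgebra B \<iota> v"

lemma v_sum_Units:
  assumes "finite A" "m \<in> A" "c m \<noteq> 0"
  shows "(\<Oplus>n\<in>A. c n \<cdot> v n) \<in> Units B" "inv (\<Oplus>n\<in>A. c n \<cdot> v n) \<in> V"
proof -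
  obtain \<alpha> where \<alpha>: "\<alpha> \<noteq> 0"
    "(\<Oplus>n\<in>Poly_Mapping.keys \<alpha>. \<iota> (Poly_Mapping.lookup \<alpha> n) \<otimes> v n) = (\<Oplus>n\<in>A. c n \<cdot> v n)"
    by (rule finsum_eq_poly_mapping[of A m c v]) (use assms in auto)
  show "(\<Oplus>n\<in>A. c n \<cdot> v n) \<in> Units B"
    using v_comb_Units[OF \<alpha>(1)] \<alpha>(2) by simp
  show "inv (\<Oplus>n\<in>A. c n \<cdot> v n) \<in> V"
    unfolding localized_subalgebra_def
    by (rule generate_ring.incl) (use \<alpha> in \<open>auto intro!: exI[of _ \<alpha>]\<close>)
qed

lemma v_diff:
  assumes "m \<noteq> n"
  shows v_diff_Units: "v m \<ominus> v n \<in> Units B" and v_diff_inv_mem: "inv (v m \<ominus> v n) \<in> V"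
proof -
  \<comment> \<open>Only the values at \<open>m\<close> and \<open>n\<close> enter the sum.
    Nonvanishing is formal, so the coefficient 1 at \<open>m\<close> suffices.\<close>
  define c :: "'i \<Rightarrow> complex" where "c = (\<lambda>_. -1)(m := 1)"
  have "v m \<ominus> v n = (\<Oplus>p\<in>{m, n}. c p \<cdot> v p)"
    using assms by (simp add: c_def minus_eq_scale scale_one)
  then show "v m \<ominus> v n \<in> Units B" "inv (v m \<ominus> v n) \<in> V"
    using v_sum_Units[of "{m, n}" m c] by (simp_all add: c_def)
qed

lemma v_comb3_inv_mem:
  assumes "distinct [k, l, i]" "a \<noteq> 0"
  shows "inv (a \<cdot> v k \<ominus> b \<cdot> v l \<oplus> d \<cdot> v i) \<in> V"
proof -
  \<comment> \<open>The default value \<open>d\<close> is the coefficient at \<open>i\<close>;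
    distinctness keeps the two updates apart from it.\<close>
  define c :: "'i \<Rightarrow> complex" where "c = (\<lambda>_. d)(k := a, l := - b)"
  have "a \<cdot> v k \<ominus> b \<cdot> v l \<oplus> d \<cdot> v i = (\<Oplus>p\<in>{k, l, i}. c p \<cdot> v p)"
    using assms by (auto simp: c_def minus_eq_scale scale_scale a_assoc)
  then show ?thesis
    using v_sum_Units(2)[of "{k, l, i}" k c] assms by (auto simp: c_def)
qed

lemma V_closed:
  shows V_v: "v m \<in> V"
    and V_scale: "a \<in> V \<Longrightarrow> c \<cdot> a \<in> V"
    and V_mult: "\<lbrakk>a \<in> V; b \<in> V\<rbrakk> \<Longrightarrow> a \<otimes> b \<in> V"
    and V_add: "\<lbrakk>a \<in> V; b \<in> V\<rbrakk> \<Longrightarrow> a \<oplus> b \<in> V"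
    and V_minus: "\<lbrakk>a \<in> V; b \<in> V\<rbrakk> \<Longrightarrow> a \<ominus> b \<in> V"
proof -
  have "\<iota> c \<in> V"
    unfolding localized_subalgebra_def by (blast intro: generate_ring.incl)
  then show "a \<in> V \<Longrightarrow> c \<cdot> a \<in> V"
    unfolding localized_subalgebra_def scale_def by (rule generate_ring.eng_mult)
qed (auto simp: localized_subalgebra_def a_minus_def intro: generate_ring.intros)

end

section \<open>Invariants of the quantum group action\<close>

locale Uq_algebra = central_algebra B \<iota> + Uq_module_algebra B \<iota> q E F K L
  for B (structure) and \<iota> q E F K L
begin

lemma action_closed [simp]:
  assumes "a \<in> carrier B"
  shows "E a \<in> carrier B" "F a \<in> carrier B" "K a \<in> carrier B" "L a \<in> carrier B"
  using linear assms by (auto simp: linear_op_def)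

lemma action_add:
  assumes "a \<in> carrier B" "b \<in> carrier B"
  shows "E (a \<oplus> b) = E a \<oplus> E b" "F (a \<oplus> b) = F a \<oplus> F b"
    "K (a \<oplus> b) = K a \<oplus> K b" "L (a \<oplus> b) = L a \<oplus> L b"
  using linear assms by (auto simp: linear_op_def)

lemma action_scale:
  assumes "a \<in> carrier B"
  shows "E (c \<cdot> a) = c \<cdot> E a" "F (c \<cdot> a) = c \<cdot> F a" "K (c \<cdot> a) = c \<cdot> K a" "L (c \<cdot> a) = c \<cdot> L a"
  using linear assms by (auto simp: linear_op_def scale_def)

lemma action_minus:
  assumes "a \<in> carrier B" "b \<in> carrier B"
  shows "E (a \<ominus> b) = E a \<ominus> E b" "F (a \<ominus> b) = F a \<ominus> F b" "K (a \<ominus> b) = K a \<ominus> K b"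
  using assms by (simp_all add: minus_eq_scale action_add action_scale)

abbreviation inv_elt :: "'a \<Rightarrow> bool" where "inv_elt \<equiv> invariant B E F K"

lemma invariant_mult: "\<lbrakk>inv_elt a; inv_elt b\<rbrakk> \<Longrightarrow> inv_elt (a \<otimes> b)"
  by (simp add: invariant_def E_mult F_mult K_mult)

text \<open>Since \<open>L\<close> undoes \<open>K\<close>, it fixes \<open>a\<close> too. The
  product rules applied to \<open>a \<otimes> inv a = \<one>\<close> then give
  \<open>a \<otimes> K (inv a) = \<one>\<close> and \<open>a \<otimes> E (inv a) = \<zero>\<close>,
  likewise for \<open>F\<close>, and the unit \<open>a\<close> cancels.\<close>

lemma invariant_inv:
  assumes "inv_elt a" "a \<in> Units B"
  shows "inv_elt (inv a)"
proof -
  have a: "a \<in> carrier B" "E a = \<zero>" "F a = \<zero>" "K a = a"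
    using assms(1) by (auto simp: invariant_def)
  have L: "L a = a"
    using LK[OF a(1)] a(4) by simp
  have "a \<otimes> K (inv a) = \<one>"
    using K_mult[of a "inv a"] assms(2) a K_one by simp
  then have K: "K (inv a) = inv a"
    using assms(2) a(1) by (metis Units_cancel_inv(2) Units_inv_closed action_closed(3) r_one)
  have "a \<otimes> E (inv a) = \<zero>"
    using E_mult[of a "inv a"] assms(2) a(1,2) L E_one by simp
  moreover have "a \<otimes> F (inv a) = \<zero>"
    using F_mult[of a "inv a"] assms(2) a(1,3) L F_one by simp
  ultimately have "E (inv a) = \<zero>" "F (inv a) = \<zero>"
    using assms(2) a(1)
    by (metis Units_cancel_inv(2) Units_inv_closed action_closed(1,2) r_null)+
  with K assms(2) show ?thesis
    by (simp add: invariant_def)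
qed

text \<open>The pairs \<open>a, b\<close> and \<open>a', b'\<close> are two doublets.
  \<open>E\<close> sends both terms to \<open>r \<cdot> (b \<otimes> b')\<close>, \<open>F\<close>
  sends both to \<open>inverse r \<cdot> (a \<otimes> a')\<close>, and the weights under
  \<open>K\<close> cancel; no exchange relation between the doublets enters.\<close>

lemma invariant_determinant:
  assumes [simp]: "a \<in> carrier B" "b \<in> carrier B" "a' \<in> carrier B" "b' \<in> carrier B"
    and "r \<noteq> 0" "r ^ 2 = q"
    and E: "E a = r \<cdot> b" "E b = \<zero>" "E a' = r \<cdot> b'" "E b' = \<zero>"
    and F: "F a = \<zero>" "F b = inverse r \<cdot> a" "F a' = \<zero>" "F b' = inverse r \<cdot> a'"
    and K: "K a = inverse r \<cdot> a" "K b = r \<cdot> b" "K a' = inverse r \<cdot> a'" "K b' = r \<cdot> b'"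
  shows "inv_elt (inverse r \<cdot> (a \<otimes> b') \<ominus> r \<cdot> (b \<otimes> a'))"
proof -
  \<comment> \<open>The product rules involve \<open>L\<close>, whose eigenvalues on
    \<open>a\<close> and \<open>b\<close> are the reciprocals of those of \<open>K\<close>.\<close>
  have "r \<cdot> L b = b" "inverse r \<cdot> L a = a"
    using LK[of a] LK[of b] K by (simp_all add: action_scale)
  then have L: "L b = inverse r \<cdot> b" "L a = r \<cdot> a"
    using \<open>r \<noteq> 0\<close> by (metis action_closed(4) assms(1,2) left_inverse right_inverse scale_one scale_scale)+
  have rr: "inverse r * inverse r = inverse q" "r * r = q" "r * inverse q = inverse r" "inverse r * q = r"
    using \<open>r \<noteq> 0\<close> by (simp_all flip: \<open>r ^ 2 = q\<close> add: power2_eq_square)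
  show ?thesis
    using \<open>r \<noteq> 0\<close>
    by (simp add: invariant_def action_minus action_scale E_mult F_mult K_mult E F K L
        scale_scale scale_one scale_zero_right scale_mult_left scale_mult_right rr)
qed

end


section \<open>The algebra of projective coordinates as a quotient\<close>

lemma free_alg_simps [simp]:
  "carrier free_alg = UNIV" "a \<otimes>\<^bsub>free_alg\<^esub> b = a * b" "a \<oplus>\<^bsub>free_alg\<^esub> b = a + b"
  "\<one>\<^bsub>free_alg\<^esub> = 1" "\<zero>\<^bsub>free_alg\<^esub> = 0"
  by (simp_all add: free_alg_def)

lemma ring_free_alg: "ring free_alg"
proof (rule ringI)
  show "abelian_group free_alg"
  proof (rule abelian_groupI)
    show "\<exists>b\<in>carrier free_alg. b \<oplus>\<^bsub>free_alg\<^esub> a = \<zero>\<^bsub>free_alg\<^esub>" for a :: "'g list \<Rightarrow>\<^sub>0 complex"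
      by (intro bexI[of _ "- a"]) simp_all
  qed (simp_all add: add_ac)
  show "monoid free_alg"
    by (rule monoidI) (simp_all add: mult.assoc)
qed (simp_all add: algebra_simps)

lemma scalar_add: "scalar (c + d) = scalar c + scalar d"
  by (simp add: scalar_def single_add)

lemma scalar_mult: "scalar (c * d) = scalar c * scalar d"
  by (simp add: scalar_def mult_single plus_list_def)

lemma scalar_one: "scalar 1 = 1"
  by (simp add: scalar_def flip: zero_list_def)

text \<open>A scalar is a multiple of the empty word, which commutes with every word; the induction
  adds one word at a time.\<close>

lemma scalar_commute: "a * scalar c = scalar c * a"
proof (induction a rule: update_induct)
  case const
  show ?case by simp
next
  case (update f w b)
  \<comment> \<open>The word \<open>w\<close> is not yet in the support of \<open>f\<close>, so the
    update adds a monomial.\<close>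
  have "Poly_Mapping.update w b f = Poly_Mapping.single w b + f"
    using update(1)
    by (intro poly_mapping_eqI)
       (auto simp: lookup_add lookup_update lookup_single in_keys_iff when_def)
  moreover have "Poly_Mapping.single w b * scalar c = scalar c * Poly_Mapping.single w b"
    by (simp add: scalar_def mult_single plus_list_def mult.commute)
  ultimately show ?case
    using update(3) by (simp add: algebra_simps)
qed

locale proj_coords_params =
  fixes q :: complex and \<mu>1 \<mu>2 :: "'i \<Rightarrow> 'i \<Rightarrow> complex"
begin

abbreviation B :: "'i coord_alg set ring" where "B \<equiv> proj_coords q \<mu>1 \<mu>2"

abbreviation cls :: "'i coord_alg \<Rightarrow> 'i coord_alg set" where "cls \<equiv> proj_class q \<mu>1 \<mu>2"

sublocale ideal: ideal "rel_ideal q \<mu>1 \<mu>2" free_alg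
  unfolding rel_ideal_def by (rule ring.genideal_ideal[OF ring_free_alg]) simp

sublocale ring B
  unfolding proj_coords_def by (rule ideal.quotient_is_ring)

lemma cls_hom: "cls \<in> ring_hom free_alg B"
  using ideal.rcos_ring_hom by (simp add: proj_coords_def proj_class_def[abs_def])

lemma cls_closed [simp]: "cls a \<in> carrier B"
  using ring_hom_closed[OF cls_hom] by simp

lemma cls_add: "cls (a + b) = cls a \<oplus>\<^bsub>B\<^esub> cls b"
  using ring_hom_add[OF cls_hom] by simp

lemma cls_mult: "cls (a * b) = cls a \<otimes>\<^bsub>B\<^esub> cls b"
  using ring_hom_mult[OF cls_hom] by simp

lemma cls_one: "cls 1 = \<one>\<^bsub>B\<^esub>"
  using ring_hom_one[OF cls_hom] by simp

lemma cls_zero: "cls 0 = \<zero>\<^bsub>B\<^esub>"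
  using cls_add[of 0 0] by (metis add.l_cancel_one add_0 cls_closed)

lemma cls_sum: "finite A \<Longrightarrow> cls (sum f A) = (\<Oplus>\<^bsub>B\<^esub>m\<in>A. cls (f m))"
  by (induction A rule: finite_induct) (simp_all add: cls_zero cls_add)

text \<open>A relator lies in the generated ideal, so its coset is zero. Every relation of the
  presentation reaches the quotient this way.\<close>

lemma cls_eqI: assumes "a - b \<in> relators q \<mu>1 \<mu>2" shows "cls a = cls b"
proof -
  have "a - b \<in> rel_ideal q \<mu>1 \<mu>2"
    using assms ring.genideal_self[OF ring_free_alg, of "relators q \<mu>1 \<mu>2"]
    by (auto simp: rel_ideal_def)
  then have "cls (a - b) = rel_ideal q \<mu>1 \<mu>2"
    unfolding proj_class_def by (rule ideal.a_rcos_const)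
  then have "cls (a - b) = \<zero>\<^bsub>B\<^esub>"
    by (simp add: proj_coords_def FactRing_def)
  moreover have "cls a = cls (a - b) \<oplus>\<^bsub>B\<^esub> cls b"
    by (simp flip: cls_add)
  ultimately show ?thesis
    by simp
qed

lemma cls_surj: "a \<in> carrier B \<Longrightarrow> \<exists>b. a = cls b"
  by (auto simp: proj_coords_def proj_class_def FactRing_def A_RCOSETS_def')

sublocale central_algebra B "\<lambda>c. cls (scalar c)"
proof unfold_locales
  show "a \<otimes>\<^bsub>B\<^esub> cls (scalar c) = cls (scalar c) \<otimes>\<^bsub>B\<^esub> a" if "a \<in> carrier B" for a c
    using cls_surj[OF that] by (metis cls_mult scalar_commute)
qed (simp_all add: scalar_add scalar_mult scalar_one cls_add cls_mult cls_one)

lemma cls_scalar_mult: "cls (scalar c * a) = scale c (cls a)"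
  by (simp add: scale_def cls_mult)

lemma cls_Y:
  shows cls_Y_Units: "cls (gen (Y m)) \<in> Units B"
    and cls_Y_inv: "inv\<^bsub>B\<^esub> (cls (gen (Y m))) = cls (gen (Yinv m))"
  by (rule inv_char[of _ "cls (gen (Yinv m))"];
      simp flip: cls_mult cls_one; rule cls_eqI; rule relators.intros)+

lemma lin_comb_Units:
  assumes "\<alpha> \<noteq> 0"
  shows "(\<Oplus>\<^bsub>B\<^esub>m\<in>Poly_Mapping.keys \<alpha>. scale (Poly_Mapping.lookup \<alpha> m)
    (cls (gen (X m)) \<otimes>\<^bsub>B\<^esub> inv\<^bsub>B\<^esub> (cls (gen (Y m))))) \<in> Units B"
proof -
  have "cls (lin_comb \<alpha>) \<in> Units B"
    by (rule inv_char(1)[of _ "cls (gen (Linv \<alpha>))"])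
       (use assms in \<open>auto simp flip: cls_mult cls_one intro!: cls_eqI relators.intros\<close>)
  then show ?thesis
    by (simp add: lin_comb_def cls_sum scale_def cls_mult cls_Y_inv)
qed

lemma coord_relations:
  assumes "q \<noteq> 0" "r ^ 2 = q" "\<And>m n. m \<noteq> n \<Longrightarrow> \<mu>2 m n \<noteq> 0"
  shows "coord_relations B (\<lambda>c. cls (scalar c)) q r \<mu>1 \<mu>2
    (\<lambda>m. cls (gen (X m))) (\<lambda>m. cls (gen (Y m)))"
proof unfold_locales
  show "(\<Oplus>\<^bsub>B\<^esub>m\<in>Poly_Mapping.keys \<alpha>. scale (Poly_Mapping.lookup \<alpha> m)
    (cls (gen (X m)) \<otimes>\<^bsub>B\<^esub> inv\<^bsub>B\<^esub> (cls (gen (Y m))))) \<in> Units B" if "\<alpha> \<noteq> 0" for \<alpha>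
    using lin_comb_Units[OF that] .
\<comment> \<open>Folding products, sums and scalars into \<open>cls\<close> leaves equations
  \<open>cls a = cls b\<close> in which \<open>a - b\<close> is literally a relator.\<close>
qed (use assms in \<open>simp_all add: cls_Y_Units flip: cls_mult cls_add cls_scalar_mult\<close>,
     (rule cls_eqI, rule relators.intros, assumption?)+)

end

text \<open>In HOL-Algebra \<open>inv\<close> is meaningful on units only; the conjuncts about
  \<open>Units B\<close> make the inverses of the brackets and of the combinations of the
  \<open>v m\<close> genuine.\<close>

theorem proposition10:
  fixes q r :: complex and \<mu>1 \<mu>2 \<mu> :: "'i \<Rightarrow> 'i \<Rightarrow> complex"
    and B :: "'i coord_alg set ring" (structure)
    and \<iota> :: "complex \<Rightarrow> 'i coord_alg set" and x y v :: "'i \<Rightarrow> 'i coord_alg set"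
    and br :: "'i \<Rightarrow> 'i \<Rightarrow> 'i coord_alg set" and C :: "'i coord_alg set"
    and E F K L :: "'i coord_alg set \<Rightarrow> 'i coord_alg set"
    and i j k l :: 'i
  assumes q: "cmod q = 1" "q \<noteq> 1" "q \<noteq> -1" "q \<noteq> \<i>" "q \<noteq> -\<i>"
    and r: "r ^ 2 = q"
    and \<mu>_def: "\<mu> = (\<lambda>m n. \<mu>1 m n / \<mu>2 m n)"
    and \<mu>_nonzero: "\<And>m n. m \<noteq> n \<Longrightarrow> \<mu>1 m n \<noteq> 0 \<and> \<mu>2 m n \<noteq> 0"
    and \<mu>_neq: "\<And>m n. m \<noteq> n \<Longrightarrow> \<mu> m n \<noteq> q + inverse q"
    and \<mu>1_sym: "\<And>m n. m \<noteq> n \<Longrightarrow> \<mu>1 n m = 1 / \<mu>1 m n"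
    and \<mu>2_sym: "\<And>m n. m \<noteq> n \<Longrightarrow> \<mu>2 n m = 1 / (\<mu>2 m n * \<mu> m n * (q + inverse q - \<mu> m n))"
    and B_def: "B = proj_coords q \<mu>1 \<mu>2"
    and \<iota>_def: "\<iota> = (\<lambda>c. proj_class q \<mu>1 \<mu>2 (scalar c))"
    and x_def: "x = (\<lambda>m. proj_class q \<mu>1 \<mu>2 (gen (X m)))"
    and y_def: "y = (\<lambda>m. proj_class q \<mu>1 \<mu>2 (gen (Y m)))"
    and action: "Uq_module_algebra B \<iota> q E F K L"
    and E_xy: "\<And>m. E (x m) = \<iota> r \<otimes> y m" "\<And>m. E (y m) = \<zero>"
    and F_xy: "\<And>m. F (x m) = \<zero>" "\<And>m. F (y m) = \<iota> (inverse r) \<otimes> x m"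
    and K_xy: "\<And>m. K (x m) = \<iota> (inverse r) \<otimes> x m" "\<And>m. K (y m) = \<iota> r \<otimes> y m"
    and v_def: "v = (\<lambda>m. \<iota> r \<otimes> x m \<otimes> inv (y m))"
    and br_def: "br = (\<lambda>m n. \<iota> (inverse r) \<otimes> x m \<otimes> y n \<ominus> \<iota> r \<otimes> y m \<otimes> x n)"
    and distinct: "distinct [i, j, k, l]"
    and C_def: "C = br i l \<otimes> inv (br k l) \<otimes> br k j \<otimes> inv (br i j)"
  shows "br k l \<in> Units B \<and> br i j \<in> Units B
    \<and> invariant B E F K C
    \<and> C \<in> localized_subalgebra B \<iota> v
    \<and> v i \<ominus> v j \<in> Units B
    \<and> \<iota> (q + inverse q - \<mu> k i) \<otimes> v k \<ominus> \<iota> (q + inverse q - \<mu> l i) \<otimes> v l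
           \<oplus> \<iota> (\<mu> k i - \<mu> l i) \<otimes> v i \<in> Units B
    \<and> C = \<iota> (q + inverse q - \<mu> l i) \<otimes> (v i \<ominus> v l)
           \<otimes> inv (\<iota> (q + inverse q - \<mu> k i) \<otimes> v k \<ominus> \<iota> (q + inverse q - \<mu> l i) \<otimes> v l
                  \<oplus> \<iota> (\<mu> k i - \<mu> l i) \<otimes> v i)
           \<otimes> (\<iota> (q + inverse q - \<mu> k i) \<otimes> v k \<ominus> \<iota> (q + inverse q - \<mu> j i) \<otimes> v j
                \<oplus> \<iota> (\<mu> k i - \<mu> j i) \<otimes> v i)
           \<otimes> \<iota> (inverse (q + inverse q - \<mu> j i)) \<otimes> inv (v i \<ominus> v j)"
proof -
  have q0: "q \<noteq> 0" and r0: "r \<noteq> 0"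
    using q(1) r by auto
  interpret P: proj_coords_params q \<mu>1 \<mu>2 .
  interpret coords: coord_relations B \<iota> q r \<mu>1 \<mu>2 x y
    unfolding B_def \<iota>_def x_def y_def using \<mu>_nonzero q0 r by (intro P.coord_relations) auto
  interpret action: Uq_algebra B \<iota> q E F K L
    using coords.central_algebra_axioms action by (rule Uq_algebra.intro)
  have v: "v = coords.v"
    by (simp add: v_def coords.v_def coords.scale_def coords.m_assoc fun_eq_iff)
  have \<mu>: "\<mu> = coords.\<mu>"
    by (simp add: \<mu>_def coords.\<mu>_def fun_eq_iff)
  have br: "br = coords.br"
    by (simp add: br_def coords.br_def coords.scale_def coords.m_assoc fun_eq_iff)
  \<comment> \<open>Dividing \<open>\<mu>1_sym\<close> by \<open>\<mu>2_sym\<close> and using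
    \<open>\<mu>1 m n = \<mu>2 m n * \<mu> m n\<close> gives
    \<open>\<mu> n m = q + inverse q - \<mu> m n\<close>.\<close>
  have \<mu>_swap: "q + inverse q - \<mu> n m = \<mu> m n" if "m \<noteq> n" for m n
    using \<mu>_nonzero[OF that] \<mu>_neq[OF that] \<mu>1_sym[OF that] \<mu>2_sym[OF that]
    by (simp add: \<mu>_def)
  have neq: "i \<noteq> j" "i \<noteq> k" "i \<noteq> l" "k \<noteq> l" "k \<noteq> j"
    using distinct by auto
  have \<mu>_nz: "\<mu> m n \<noteq> 0" if "m \<noteq> n" for m n
    using \<mu>_nonzero[OF that] by (simp add: \<mu>_def)
  have \<mu>_diff: "\<mu> k i - \<mu> n i = \<mu> i n - \<mu> i k" if "i \<noteq> n" for n
    using \<mu>_swap[OF that] \<mu>_swap[OF neq(2)] by (simp add: algebra_simps)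
  have br_invariant: "action.inv_elt (br m n)" for m n
    unfolding br coords.br_def
    by (rule action.invariant_determinant)
       (use r r0 E_xy F_xy K_xy in \<open>simp_all add: coords.scale_def\<close>)
  have br_Units: "br k l \<in> Units B" "br i j \<in> Units B"
    using neq by (simp_all add: br coords.br_Units coords.v_diff_Units)
  have "action.inv_elt C"
    unfolding C_def
    by (intro action.invariant_mult action.invariant_inv br_invariant br_Units)
  have D_Units: "v i \<ominus> v j \<in> Units B" "v k \<ominus> v l \<in> Units B"
    using neq by (simp_all add: v coords.v_diff_Units)
  \<comment> \<open>By \<open>\<mu>_swap\<close> and \<open>\<mu>_diff\<close>, \<open>W l\<close>
    is the inverted factor of the claimed formula and \<open>W j\<close> the factor after
    it.\<close>
  define W where "W n = \<iota> (\<mu> i k) \<otimes> v k \<ominus> \<iota> (\<mu> i n) \<otimes> v n \<oplus> \<iota> (\<mu> i n - \<mu> i k) \<otimes> v i" for n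
  note cross = coords.cross_ratio[folded br \<mu> v, unfolded coords.scale_def, OF distinct
      \<mu>_nz[OF neq(1)] D_Units(2,1), folded W_def C_def]
  have W_V: "W n \<in> coords.V" for n
    unfolding W_def v coords.scale_def[symmetric]
    by (intro coords.V_add coords.V_minus coords.V_scale coords.V_v)
  \<comment> \<open>For \<open>W l\<close> the nonzero coefficient is \<open>\<mu> i k\<close>, at
    \<open>v k\<close>.\<close>
  have inv_V: "inv (v i \<ominus> v j) \<in> coords.V" "inv (W l) \<in> coords.V"
    using coords.v_diff_inv_mem[OF neq(1)] neq \<mu>_nz
      coords.v_comb3_inv_mem[of k l i "\<mu> i k" "\<mu> i l" "\<mu> i l - \<mu> i k"]
    by (simp_all add: v W_def coords.scale_def)
  have "C \<in> localized_subalgebra B \<iota> v"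
    unfolding cross(2) v
    unfolding coords.scale_def[symmetric]
    by (intro coords.V_mult coords.V_minus coords.V_scale coords.V_v W_V inv_V[unfolded v])
  moreover have "C = \<iota> (\<mu> i l) \<otimes> (v i \<ominus> v l) \<otimes> inv (W l) \<otimes> W j \<otimes> \<iota> (inverse (\<mu> i j))
      \<otimes> inv (v i \<ominus> v j)"
    unfolding cross(2) using cross(1) D_Units by (simp add: coords.m_assoc W_def v)
  ultimately show ?thesis
    unfolding \<mu>_swap[OF neq(1)] \<mu>_swap[OF neq(2)] \<mu>_swap[OF neq(3)]
      \<mu>_diff[OF neq(1)] \<mu>_diff[OF neq(3)] W_def[symmetric]
    using br_Units \<open>action.inv_elt C\<close> D_Units(1) cross(1) by blast
qed

end
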